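(* Let $d\ge 1$ and $m\ge 2$ be integers, let $\boldsymbol{\Omega}=\{\Omega_{\boldsymbol{i}}:\boldsymbol{i}\in\mathbb{N}_m^d\}$ be the jittered partition of $[0,1]^d$ into $m^d$ cubes, and let $\mathcal{P}_{\boldsymbol{\Omega}}$ be the associated jittered point set of $N=m^d$ random points. Then the Hickernell $\mathcal{L}_2$-discrepancy $D_{H,2}$ satisfies $$\mathbb{E}\,D_{H,2}^2(\mathcal{P}_{\boldsymbol{\Omega}})=\sum_{j=1}^d\frac{1}{m^{d+j}}\binom{d}{j}\left[\left(\frac{m-1}{2}+\frac12\right)^j-\left(\frac{m-1}{2}+\frac13\right)^j\right].$$
   Context: $\mathbb{N}_m^d$ is the set of $d$-tuples $\boldsymbol{i}=(i_1,\dots,i_d)$ with entries in $\{1,\dots,m\}$. The jittered partition of $[0,1]^d$ consists of the $m^d$ axis-aligned cubes $\Omega_{\boldsymbol{i}}=\prod_{j=1}^d\left[\frac{i_j-1}{m},\frac{i_j}{m}\right]$, $\boldsymbol{i}\in\mathbb{N}_m^d$, of equal volume $m^{-d}$ (they overlap only on boundaries). The jittered point set $\mathcal{P}_{\boldsymbol{\Omega}}$ consists of $N=m^d$ independent random points, one uniformly distributed in each $\Omega_{\boldsymbol{i}}$. For a nonempty $s\subseteq\{1,\dots,d\}$, $[0,1]^s$ is the $|s|$-dimensional unit cube spanned by the coordinates in $s$, $\mathbf{x}^s$ is the projection of $\mathbf{x}\in[0,1]^d$ to the coordinates in $s$, and for a point set $\mathcal{P}=\{\mathbf{x}_1,\dots,\mathbf{x}_N\}\subset[0,1]^d$,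 $\mathcal{P}^s$ is the projected (multi)set $\{\mathbf{x}_1^s,\dots,\mathbf{x}_N^s\}$. Its $\mathcal{L}_2$-discrepancy is $$\mathcal{L}_2(\mathcal{P}^s)=\left(\int_{[0,1]^s}\left|\frac{\#(\mathcal{P}^s\cap[0,\mathbf{x}^s))}{N}-|[0,\mathbf{x}^s)|\right|^2d\mathbf{x}^s\right)^{1/2},$$ where $[0,\mathbf{x}^s)=\prod_{j\in s}[0,x_j)$, $|\cdot|$ of a set is $|s|$-dimensional Lebesgue measure, and $\#(\mathcal{P}^s\cap[0,\mathbf{x}^s))$ is the number of indices $k\in\{1,\dots,N\}$ with $\mathbf{x}_k^s\in[0,\mathbf{x}^s)$. The Hickernell $\mathcal{L}_2$-discrepancy is $$D_{H,2}(\mathcal{P})=\left(\sum_{\emptyset\ne s\subseteq\{1,\dots,d\}}\mathcal{L}_2^2(\mathcal{P}^s)\right)^{1/2},$$ and $\mathbb{E}D_{H,2}^2(\mathcal{P})$ means $\mathbb{E}[D_{H,2}(\mathcal{P})^2]$. *)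

theory Defs
  imports "HOL-Probability.Probability"
begin

text \<open>
  A point with coordinates indexed by a finite set \<open>s\<close> of naturals is an extensional
  function in \<open>PiE s (\<lambda>_. UNIV)\<close>.  This allows the dimension, and the coordinate set
  of a projection, to vary inside a formula.
\<close>

abbreviation leb :: "nat set \<Rightarrow> (nat \<Rightarrow> real) measure" where
  "leb s \<equiv> PiM s (\<lambda>_. lborel)"

definition unit_cube :: "nat set \<Rightarrow> (nat \<Rightarrow> real) set" where
  "unit_cube s = PiE s (\<lambda>_. {0..1})"

definition anchored_box :: "nat set \<Rightarrow> (nat \<Rightarrow> real) \<Rightarrow> (nat \<Rightarrow> real) set" where
  "anchored_box s x = PiE s (\<lambda>j. {0..<x j})"

text \<open>
  A point set of \<open>N = card K\<close> points is a family \<open>p\<close> indexed by a finite set \<open>K\<close>, so that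
  coinciding points (or coinciding projections) are counted with multiplicity.  The
  restriction of a point to \<open>s\<close> is its projection to the coordinates in \<open>s\<close>.
\<close>

definition L2_discrepancy :: "nat set \<Rightarrow> 'k set \<Rightarrow> ('k \<Rightarrow> nat \<Rightarrow> real) \<Rightarrow> real" where
  "L2_discrepancy s K p =
     sqrt (LINT x:unit_cube s|leb s.
       \<bar>real (card {k \<in> K. restrict (p k) s \<in> anchored_box s x}) / real (card K)
        - measure (leb s) (anchored_box s x)\<bar>\<^sup>2)"

definition hickernell_discrepancy :: "nat \<Rightarrow> 'k set \<Rightarrow> ('k \<Rightarrow> nat \<Rightarrow> real) \<Rightarrow> real" where
  "hickernell_discrepancy d K p =
     sqrt (\<Sum>s\<in>Pow {1..d} - {{}}. (L2_discrepancy s K p)\<^sup>2)"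

definition multi_indices :: "nat \<Rightarrow> nat \<Rightarrow> (nat \<Rightarrow> nat) set" where
  "multi_indices d m = PiE {1..d} (\<lambda>_. {1..m})"

definition jittered_cube :: "nat \<Rightarrow> nat \<Rightarrow> (nat \<Rightarrow> nat) \<Rightarrow> (nat \<Rightarrow> real) set" where
  "jittered_cube d m i = PiE {1..d} (\<lambda>j. {(real (i j) - 1) / real m .. real (i j) / real m})"

text \<open>
  The random points are arbitrary random variables on an arbitrary probability space \<open>M\<close>;
  their measurability is part of the independence condition.
\<close>

definition jittered_point_set ::
    "nat \<Rightarrow> nat \<Rightarrow> 'a measure \<Rightarrow> ((nat \<Rightarrow> nat) \<Rightarrow> 'a \<Rightarrow> nat \<Rightarrow> real) \<Rightarrow> bool" where
  "jittered_point_set d m M X \<longleftrightarrow>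
     prob_space M \<and>
     prob_space.indep_vars M (\<lambda>_. leb {1..d}) X (multi_indices d m) \<and>
     (\<forall>i\<in>multi_indices d m.
        distr M (leb {1..d}) (X i) = uniform_measure (leb {1..d}) (jittered_cube d m i))"

end

theory Submission imports Defs begin

text \<open>
  For a fixed corner \<open>x\<close> and a coordinate set \<open>s\<close>, the number of projected points in the box
  anchored at \<open>x\<close> is a sum of independent Bernoulli variables, one for each cell.  The success
  probability \<open>p\<^sub>i\<close> of the cell \<open>i\<close> factorizes over the coordinates in \<open>s\<close>, with factors
  given by the distribution functions of the uniform laws on the intervals
  \<open>[(a - 1) / m, a / m]\<close>.  These functions add up over \<open>a\<close> to \<open>m t\<close>, which says that the count
  has mean \<open>N\<close> times the volume of the box: jittered sampling is unbiased.  Hence the expected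
  squared local discrepancy is the variance \<open>\<Sum> p\<^sub>i (1 - p\<^sub>i)\<close> divided by \<open>N\<^sup>2\<close>
  (\<open>expectation_local_discrepancy\<close>).

  Integrating over \<open>x\<close> requires exchanging expectation and integral, which Fubini allows
  since the local discrepancy is bounded by 1 on the unit cube.  Both \<open>\<Sum> p\<^sub>i\<close> and
  \<open>\<Sum> p\<^sub>i\<^sup>2\<close> are sums over a grid of products of one-variable functions, so their integrals
  are powers of one-dimensional integrals: \<open>m / 2\<close> for the sum of the distribution functions
  and \<open>(m - 1) / 2 + 1 / 3\<close> for the sum of their squares.  Each coordinate outside \<open>s\<close> only
  contributes a factor \<open>m\<close>.  The outcome (\<open>expectation_L2_discrepancy\<close>) depends on \<open>s\<close> through
  its cardinality \<open>j\<close> alone, and the binomial coefficient counts the sets of each cardinality.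
\<close>

section \<open>The distribution function of the uniform law on a cell\<close>

definition cell_cdf :: "nat \<Rightarrow> nat \<Rightarrow> real \<Rightarrow> real" where
  "cell_cdf m a t = max 0 (min 1 (real m * t - (real a - 1)))"

lemma cell_cdf_bounds: "0 \<le> cell_cdf m a t" "cell_cdf m a t \<le> 1"
  by (auto simp: cell_cdf_def)

lemma cell_cdf_measurable [measurable]: "cell_cdf m a \<in> borel_measurable borel"
  unfolding cell_cdf_def by measurable

lemma measure_cell_Int_initial_interval:
  assumes "1 \<le> a" "m \<ge> 1"
  shows "real m * measure lborel ({(real a - 1) / real m .. real a / real m} \<inter> {0..<t}) = cell_cdf m a t"
proof (cases "t \<le> real a / real m")
  case True
  have "0 \<le> (real a - 1) / real m" using assms by simp
  hence "{(real a - 1) / real m .. real a / real m} \<inter> {0..<t} = {(real a - 1) / real m ..< t}"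
    using True by auto
  moreover have "real m * t \<le> real a" using True assms by (simp add: field_simps)
  ultimately show ?thesis
    using assms by (cases "(real a - 1) / real m \<le> t") (auto simp: cell_cdf_def field_simps)
next
  case False
  have "0 \<le> (real a - 1) / real m" using assms by simp
  hence "{(real a - 1) / real m .. real a / real m} \<inter> {0..<t} = {(real a - 1) / real m .. real a / real m}"
    using False by auto
  moreover have "real m * t > real a" using False assms by (simp add: field_simps)
  ultimately show ?thesis
    using assms by (auto simp: cell_cdf_def field_simps)
qed

text \<open>
  Each term is the length of the part of \<open>[0, m t]\<close> that lies in \<open>[a - 1, a]\<close>, so the sum is
  the part in \<open>[0, n]\<close>; with the number of terms decoupled from \<open>m\<close>, the identity is inductive in \<open>n\<close>.
\<close>

lemma sum_cell_cdf_clamp: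
  "(\<Sum>a=1..n. cell_cdf m a t) = max 0 (min (real n) (real m * t))"
  by (induction n) (auto simp: cell_cdf_def max_def min_def)

lemma sum_cell_cdf:
  assumes "0 \<le> t" "t \<le> 1"
  shows "(\<Sum>a=1..m. cell_cdf m a t) = real m * t"
  using assms mult_left_mono[of t 1 "real m"] unfolding sum_cell_cdf_clamp by simp

text \<open>
  The three pieces lie before, in and after the cell; the cell contributes a rescaled
  \<open>\<integral> u\<^sup>2 du = 1 / 3\<close>, and the part after it contributes its length.
\<close>

lemma has_integral_cell_cdf_square:
  assumes "1 \<le> a" "a \<le> m"
  shows "((\<lambda>t. (cell_cdf m a t)\<^sup>2) has_integral (1 - real a / real m + 1 / (3 * real m))) {0..1}"
proof -
  let ?l = "(real a - 1) / real m" and ?r = "real a / real m"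
  have m: "real m > 0" using assms by simp
  have ord: "0 \<le> ?l" "?l \<le> ?r" "?r \<le> 1" using assms by (auto simp: divide_right_mono)
  have "((\<lambda>t. 0::real) has_integral 0) {0..?l}" by simp
  hence 1: "((\<lambda>t. (cell_cdf m a t)\<^sup>2) has_integral 0) {0..?l}"
    by (rule has_integral_eq[rotated]) (use m in \<open>auto simp: cell_cdf_def field_simps\<close>)
  have "((\<lambda>t. (real m * t - (real a - 1))\<^sup>2) has_integral
          ((real m * ?r - (real a - 1)) ^ 3 / (3 * real m) - (real m * ?l - (real a - 1)) ^ 3 / (3 * real m)))
          {?l..?r}"
    using ord(2) m by (intro fundamental_theorem_of_calculus)
       (auto intro!: derivative_eq_intros simp flip: has_real_derivative_iff_has_vector_derivative
             simp: field_simps power2_eq_square)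
  hence "((\<lambda>t. (real m * t - (real a - 1))\<^sup>2) has_integral 1 / (3 * real m)) {?l..?r}"
    using m by simp
  hence 2: "((\<lambda>t. (cell_cdf m a t)\<^sup>2) has_integral 1 / (3 * real m)) {?l..?r}"
    by (rule has_integral_eq[rotated]) (use m in \<open>auto simp: cell_cdf_def field_simps\<close>)
  have "((\<lambda>t. 1::real) has_integral (1 - ?r)) {?r..1}"
    using has_integral_const_real[of "1::real" ?r 1] ord by simp
  hence 3: "((\<lambda>t. (cell_cdf m a t)\<^sup>2) has_integral (1 - ?r)) {?r..1}"
    by (rule has_integral_eq[rotated]) (use m in \<open>auto simp: cell_cdf_def field_simps\<close>)
  have "((\<lambda>t. (cell_cdf m a t)\<^sup>2) has_integral (0 + 1 / (3 * real m))) {0..?r}"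
    using ord by (intro has_integral_combine[OF _ _ 1 2])
  hence "((\<lambda>t. (cell_cdf m a t)\<^sup>2) has_integral (0 + 1 / (3 * real m) + (1 - ?r))) {0..1}"
    using ord by (intro has_integral_combine[OF _ _ _ 3]) auto
  thus ?thesis by (simp add: algebra_simps)
qed

lemma integrable_indicator_cell_cdf_power:
  "integrable lborel (\<lambda>t. indicat_real {0..1} t * cell_cdf m a t ^ n)"
  by (rule integrableI_bounded_set[where A = "{0..1}" and B = 1])
     (auto simp: cell_cdf_bounds power_le_one)

lemma integral_sum_cell_cdf:
  "(\<integral>t. indicat_real {0..1} t * (\<Sum>a=1..m. cell_cdf m a t) \<partial>lborel) = real m / 2"
proof -
  have "(\<integral>t. indicat_real {0..1} t * (\<Sum>a=1..m. cell_cdf m a t) \<partial>lborel)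
      = (\<integral>t. real m * (t ^ 1 * indicat_real {0..1} t) \<partial>lborel)"
    by (intro Bochner_Integration.integral_cong) (auto simp: indicator_def sum_cell_cdf simp del: One_nat_def)
  also have "\<dots> = real m / 2"
    by (subst integral_mult_right_zero, subst integral_power) auto
  finally show ?thesis .
qed

lemma integral_sum_cell_cdf_square:
  "(\<integral>t. indicat_real {0..1} t * (\<Sum>a=1..m. (cell_cdf m a t)\<^sup>2) \<partial>lborel) = (real m - 1) / 2 + 1 / 3"
  if "m \<ge> 1"
proof -
  have cell: "(\<integral>t. indicat_real {0..1} t * (cell_cdf m a t)\<^sup>2 \<partial>lborel) = 1 - real a / real m + 1 / (3 * real m)"
    if "a \<in> {1..m}" for a
  proof -
    have "set_integrable lborel {0..1} (\<lambda>t. (cell_cdf m a t)\<^sup>2)"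
      using integrable_indicator_cell_cdf_power[of m a 2] by (simp add: set_integrable_def)
    from set_borel_integral_eq_integral(2)[OF this] show ?thesis
      using has_integral_cell_cdf_square[of a m] that
      by (simp add: set_lebesgue_integral_def integral_unique)
  qed
  have "(\<integral>t. indicat_real {0..1} t * (\<Sum>a=1..m. (cell_cdf m a t)\<^sup>2) \<partial>lborel)
      = (\<Sum>a=1..m. \<integral>t. indicat_real {0..1} t * (cell_cdf m a t)\<^sup>2 \<partial>lborel)"
    unfolding sum_distrib_left
    by (intro Bochner_Integration.integral_sum integrable_indicator_cell_cdf_power)
  also have "\<dots> = (\<Sum>a=1..m. 1 - real a / real m + 1 / (3 * real m))"
    by (rule sum.cong) (auto simp: cell)
  also have "\<dots> = real m - (\<Sum>a=1..m. real a) / real m + 1 / 3"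
    using that by (simp add: sum.distrib sum_subtractf sum_divide_distrib)
  also have "(\<Sum>a=1..m. real a) = real m * (real m + 1) / 2"
    by (induction m) (auto simp: field_simps)
  also have "real m - real m * (real m + 1) / 2 / real m + 1 / 3 = (real m - 1) / 2 + 1 / 3"
    using that by (simp add: field_simps)
  finally show ?thesis .
qed

section \<open>Products over coordinates\<close>

interpretation lborel_product: product_sigma_finite "\<lambda>_::nat. lborel :: real measure" ..

lemma measure_leb_PiE:
  assumes "finite s" "\<And>j. j \<in> s \<Longrightarrow> A j \<in> sets borel" "\<And>j. j \<in> s \<Longrightarrow> emeasure lborel (A j) \<noteq> \<infinity>"
  shows "emeasure (leb s) (PiE s A) = ennreal (\<Prod>j\<in>s. measure lborel (A j))"
    and "measure (leb s) (PiE s A) = (\<Prod>j\<in>s. measure lborel (A j))"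
proof -
  have "emeasure (leb s) (PiE s A) = (\<Prod>j\<in>s. emeasure lborel (A j))"
    using assms by (subst lborel_product.emeasure_PiM) auto
  also have "\<dots> = (\<Prod>j\<in>s. ennreal (measure lborel (A j)))"
    using assms(3) by (intro prod.cong) (auto simp: emeasure_eq_ennreal_measure)
  also have "\<dots> = ennreal (\<Prod>j\<in>s. measure lborel (A j))"
    by (rule prod_ennreal) simp
  finally show *: "emeasure (leb s) (PiE s A) = ennreal (\<Prod>j\<in>s. measure lborel (A j))" .
  show "measure (leb s) (PiE s A) = (\<Prod>j\<in>s. measure lborel (A j))"
    unfolding measure_def using * by (simp add: measure_def prod_nonneg)
qed

lemma measure_anchored_box:
  assumes "finite s" "x \<in> unit_cube s"
  shows "measure (leb s) (anchored_box s x) = (\<Prod>j\<in>s. x j)"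
  unfolding anchored_box_def using assms
  by (subst measure_leb_PiE(2)) (auto simp: unit_cube_def PiE_iff intro!: prod.cong)

lemma indicator_unit_cube:
  assumes "x \<in> space (leb s)" "finite s"
  shows "indicat_real (unit_cube s) x = (\<Prod>j\<in>s. indicat_real {0..1} (x j))"
proof (cases "x \<in> unit_cube s")
  case True
  thus ?thesis by (auto simp: unit_cube_def PiE_iff indicator_def)
next
  case False
  then obtain j where "j \<in> s" "x j \<notin> {0..1}"
    using assms by (auto simp: unit_cube_def space_PiM PiE_iff)
  hence "(\<Prod>j\<in>s. indicat_real {0..1} (x j)) = 0"
    using assms(2) by (intro prod_zero) (auto intro!: bexI[of _ j])
  thus ?thesis using False by simp
qed

lemma integral_unit_cube_prod:
  assumes "finite s" "integrable lborel (\<lambda>t. indicat_real {0..1} t * g t)"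
  shows "(\<integral>x. indicat_real (unit_cube s) x * (\<Prod>j\<in>s. g (x j)) \<partial>leb s)
       = (\<integral>t. indicat_real {0..1} t * g t \<partial>lborel) ^ card s"
    and "integrable (leb s) (\<lambda>x. indicat_real (unit_cube s) x * (\<Prod>j\<in>s. g (x j)))"
proof -
  have eq: "indicat_real (unit_cube s) x * (\<Prod>j\<in>s. g (x j)) = (\<Prod>j\<in>s. indicat_real {0..1} (x j) * g (x j))"
    if "x \<in> space (leb s)" for x
    using that assms(1) by (simp add: indicator_unit_cube prod.distrib)
  show "(\<integral>x. indicat_real (unit_cube s) x * (\<Prod>j\<in>s. g (x j)) \<partial>leb s)
       = (\<integral>t. indicat_real {0..1} t * g t \<partial>lborel) ^ card s"
    using lborel_product.product_integral_prod[OF assms(1), of "\<lambda>_ t. indicat_real {0..1} t * g t"] assms(2)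
    by (subst Bochner_Integration.integral_cong[OF refl eq]) auto
  show "integrable (leb s) (\<lambda>x. indicat_real (unit_cube s) x * (\<Prod>j\<in>s. g (x j)))"
    using lborel_product.product_integrable_prod[OF assms(1), of "\<lambda>_ t. indicat_real {0..1} t * g t"] assms(2)
    by (subst Bochner_Integration.integrable_cong[OF refl eq]) auto
qed

text \<open>
  Distributivity over the grid, where a coordinate that does not enter the product
  contributes the number \<open>m\<close> of its possible indices.
\<close>

lemma sum_multi_indices_prod:
  fixes g :: "nat \<Rightarrow> nat \<Rightarrow> real"
  assumes "s \<subseteq> {1..d}"
  shows "(\<Sum>i\<in>multi_indices d m. \<Prod>j\<in>s. g (i j) j) = real m ^ (d - card s) * (\<Prod>j\<in>s. \<Sum>a=1..m. g a j)"
proof -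
  have fin: "finite s" using assms finite_subset by blast
  \<comment> \<open>Extending a product over \<open>s\<close> by constants to all coordinates makes it a product over the grid's index set.\<close>
  have split: "(\<Prod>j\<in>{1..d}. if j \<in> s then f j else c) = (\<Prod>j\<in>s. f j) * c ^ (d - card s)"
    for f :: "nat \<Rightarrow> real" and c
  proof -
    have "{1..d} \<inter> {j. j \<in> s} = s" "{1..d} \<inter> - {j. j \<in> s} = {1..d} - s" using assms by auto
    moreover have "card ({1..d} - s) = d - card s" using assms by (simp add: card_Diff_subset fin)
    ultimately show ?thesis by (subst prod.If_cases) auto
  qed
  have "(\<Sum>i\<in>multi_indices d m. \<Prod>j\<in>s. g (i j) j)
      = (\<Sum>i\<in>multi_indices d m. \<Prod>j\<in>{1..d}. if j \<in> s then g (i j) j else 1)"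
    by (simp only: split power_one mult_1_right)
  also have "\<dots> = (\<Prod>j\<in>{1..d}. \<Sum>a=1..m. if j \<in> s then g a j else 1)"
    unfolding multi_indices_def by (subst prod_sum_PiE) auto
  also have "\<dots> = (\<Prod>j\<in>{1..d}. if j \<in> s then (\<Sum>a=1..m. g a j) else real m)"
    by (intro prod.cong) auto
  also have "\<dots> = real m ^ (d - card s) * (\<Prod>j\<in>s. \<Sum>a=1..m. g a j)"
    by (simp only: split mult.commute)
  finally show ?thesis .
qed

lemma finite_multi_indices [simp]: "finite (multi_indices d m)"
  by (simp add: multi_indices_def finite_PiE)

lemma card_multi_indices: "card (multi_indices d m) = m ^ d"
  by (simp add: multi_indices_def card_PiE)

section \<open>Counting independent events\<close>

text \<open>
  Bienayme's argument: in the expanded square the covariances of distinct events vanish by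
  independence, and the diagonal leaves the Bernoulli variances.
\<close>

lemma (in prob_space) count_indep_variance:
  assumes fin: "finite K" and ind: "indep_vars N X K" and B: "\<And>k. k \<in> K \<Longrightarrow> B k \<in> sets (N k)"
  defines "p \<equiv> \<lambda>k. prob (X k -` B k \<inter> space M)"
  shows "expectation (\<lambda>\<omega>. (real (card {k\<in>K. X k \<omega> \<in> B k}) - (\<Sum>k\<in>K. p k))\<^sup>2) = (\<Sum>k\<in>K. p k * (1 - p k))"
proof -
  let ?E = "\<lambda>k. X k -` B k \<inter> space M"
  let ?I = "\<lambda>k. indicat_real (?E k)"
  have E [measurable]: "?E k \<in> events" if "k \<in> K" for k
    using ind that B[OF that] unfolding indep_vars_def2 by (auto intro: measurable_sets)
  have joint: "prob (?E k \<inter> ?E l) = (if k = l then p k else p k * p l)" if "k \<in> K" "l \<in> K" for k l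
  proof (cases "k = l")
    case False
    have "prob (\<Inter>i\<in>{k, l}. ?E i) = (\<Prod>i\<in>{k, l}. prob (?E i))"
      using that B by (intro indep_varsD[OF ind]) auto
    thus ?thesis using False by (simp add: p_def)
  qed (simp add: p_def)
  have int: "integrable M (?I k)" if "k \<in> K" for k
    using that by (intro integrable_real_indicator) (auto simp: emeasure_eq_measure)
  have int2: "integrable M (\<lambda>\<omega>. ?I k \<omega> * ?I l \<omega>)" if "k \<in> K" "l \<in> K" for k l
    unfolding indicator_inter_arith[symmetric] using that
    by (intro integrable_real_indicator) (auto simp: emeasure_eq_measure)
  \<comment> \<open>On the diagonal the product of the indicators is the indicator itself, whence the variance.\<close>
  have cov: "expectation (\<lambda>\<omega>. (?I k \<omega> - p k) * (?I l \<omega> - p l)) = (if k = l then p k * (1 - p k) else 0)"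
    if "k \<in> K" "l \<in> K" for k l
  proof -
    have "expectation (\<lambda>\<omega>. (?I k \<omega> - p k) * (?I l \<omega> - p l))
        = expectation (\<lambda>\<omega>. ?I k \<omega> * ?I l \<omega> - p l * ?I k \<omega> - p k * ?I l \<omega> + p k * p l)"
      by (simp add: algebra_simps)
    also have "\<dots> = expectation (\<lambda>\<omega>. ?I k \<omega> * ?I l \<omega>) - p l * expectation (?I k) - p k * expectation (?I l) + p k * p l"
      using that int int2 by (simp add: prob_space)
    also have "expectation (\<lambda>\<omega>. ?I k \<omega> * ?I l \<omega>) = prob (?E k \<inter> ?E l)"
      unfolding indicator_inter_arith[symmetric] using E that by (simp add: Int_assoc Int_commute Int_left_commute)
    also have "expectation (?I k) = p k" using E[OF that(1)] by (simp add: p_def)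
    also have "expectation (?I l) = p l" using E[OF that(2)] by (simp add: p_def)
    also have "prob (?E k \<inter> ?E l) - p l * p k - p k * p l + p k * p l = (if k = l then p k * (1 - p k) else 0)"
      by (simp add: joint[OF that] algebra_simps)
    finally show ?thesis .
  qed
  have intc: "integrable M (\<lambda>\<omega>. (?I k \<omega> - p k) * (?I l \<omega> - p l))" if "k \<in> K" "l \<in> K" for k l
  proof -
    have "integrable M (\<lambda>\<omega>. ?I k \<omega> * ?I l \<omega> - p l * ?I k \<omega> - p k * ?I l \<omega> + p k * p l)"
      using that int int2 by auto
    thus ?thesis by (simp add: algebra_simps)
  qed
  have "expectation (\<lambda>\<omega>. (real (card {k\<in>K. X k \<omega> \<in> B k}) - (\<Sum>k\<in>K. p k))\<^sup>2)
      = expectation (\<lambda>\<omega>. \<Sum>k\<in>K. \<Sum>l\<in>K. (?I k \<omega> - p k) * (?I l \<omega> - p l))"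
  proof (rule Bochner_Integration.integral_cong[OF refl])
    fix \<omega> assume "\<omega> \<in> space M"
    hence "real (card {k\<in>K. X k \<omega> \<in> B k}) = (\<Sum>k\<in>K. ?I k \<omega>)"
      using fin by (simp add: indicator_def sum.If_cases Int_def)
    thus "(real (card {k\<in>K. X k \<omega> \<in> B k}) - (\<Sum>k\<in>K. p k))\<^sup>2 = (\<Sum>k\<in>K. \<Sum>l\<in>K. (?I k \<omega> - p k) * (?I l \<omega> - p l))"
      by (simp add: power2_eq_square sum_product flip: sum_subtractf)
  qed
  also have "\<dots> = (\<Sum>k\<in>K. \<Sum>l\<in>K. expectation (\<lambda>\<omega>. (?I k \<omega> - p k) * (?I l \<omega> - p l)))"
    using intc by (simp add: Bochner_Integration.integral_sum)
  also have "\<dots> = (\<Sum>k\<in>K. p k * (1 - p k))"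
    using fin by (simp add: cov sum.delta cong: sum.cong)
  finally show ?thesis .
qed

section \<open>The discrepancy of the projected point set\<close>

lemma restrict_in_anchored_box_iff:
  "restrict y s \<in> anchored_box s x \<longleftrightarrow> (\<forall>j\<in>s. 0 \<le> y j \<and> y j < x j)"
  by (auto simp: anchored_box_def PiE_iff)

lemma sets_projection_in_anchored_box:
  assumes "finite D" "s \<subseteq> D"
  shows "{y \<in> space (leb D). restrict y s \<in> anchored_box s x} \<in> sets (leb D)"
proof -
  have fin: "finite s" using assms finite_subset by blast
  have [measurable]: "(\<lambda>y. y j) \<in> borel_measurable (leb D)" if "j \<in> s" for j
    using measurable_component_singleton[of j D "\<lambda>_. lborel"] that assms(2) by auto
  have "{y \<in> space (leb D). \<forall>j\<in>s. 0 \<le> y j \<and> y j < x j} \<in> sets (leb D)"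
    using fin by measurable
  thus ?thesis by (simp add: restrict_in_anchored_box_iff)
qed

text \<open>
  Both the cell and the condition on \<open>y\<close> are products of one-dimensional conditions, so
  normalizing by the volume \<open>m\<close> to the power \<open>-d\<close> amounts to normalizing each coordinate by its
  side length; the coordinates outside \<open>s\<close> then have probability 1.
\<close>

lemma uniform_jittered_cube_anchored_box:
  assumes "m \<ge> 1" "i \<in> multi_indices d m" "s \<subseteq> {1..d}"
  shows "measure (uniform_measure (leb {1..d}) (jittered_cube d m i))
           {y \<in> space (leb {1..d}). restrict y s \<in> anchored_box s x} = (\<Prod>j\<in>s. cell_cdf m (i j) (x j))"
proof -
  let ?D = "{1..d}" and ?c = "\<lambda>j. {(real (i j) - 1) / real m .. real (i j) / real m}"
  let ?B = "{y \<in> space (leb ?D). restrict y s \<in> anchored_box s x}"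
  have m: "real m > 0" using assms(1) by simp
  have i: "1 \<le> i j" if "j \<in> ?D" for j
    using assms(2) that by (auto simp: multi_indices_def PiE_iff)
  have fin: "finite s" using assms(3) finite_subset by blast
  have vol: "measure lborel (?c j) = 1 / real m" for j
    using m by (simp add: field_simps)
  have fin_c: "emeasure lborel (?c j) \<noteq> \<infinity>" for j
    by (simp add: emeasure_lborel_Icc_eq)
  have em: "emeasure (leb ?D) (jittered_cube d m i) = ennreal ((1 / real m) ^ d)"
    unfolding jittered_cube_def using fin_c
    by (subst measure_leb_PiE(1)) (simp_all only: vol prod_constant card_atLeastAtMost, simp_all)
  have me: "measure (leb ?D) (jittered_cube d m i) = (1 / real m) ^ d"
    unfolding jittered_cube_def using fin_c
    by (subst measure_leb_PiE(2)) (simp_all only: vol prod_constant card_atLeastAtMost, simp_all)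
  have sets: "jittered_cube d m i \<in> sets (leb ?D)"
    unfolding jittered_cube_def by (intro sets_PiM_I_finite) auto
  have Bs: "?B \<in> sets (leb ?D)"
    by (rule sets_projection_in_anchored_box[OF _ assms(3)]) simp
  have cap: "jittered_cube d m i \<inter> ?B = PiE ?D (\<lambda>j. if j \<in> s then ?c j \<inter> {0..<x j} else ?c j)" (is "_ = PiE ?D ?A")
  proof (rule set_eqI)
    fix y
    have "(\<forall>j\<in>?D. y j \<in> ?A j) \<longleftrightarrow> (\<forall>j\<in>?D. y j \<in> ?c j \<and> (j \<in> s \<longrightarrow> 0 \<le> y j \<and> y j < x j))"
      by (intro ball_cong) auto
    also have "\<dots> \<longleftrightarrow> (\<forall>j\<in>?D. y j \<in> ?c j) \<and> (\<forall>j\<in>s. 0 \<le> y j \<and> y j < x j)"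
      using assms(3) by blast
    finally show "y \<in> jittered_cube d m i \<inter> ?B \<longleftrightarrow> y \<in> PiE ?D ?A"
      by (auto simp only: jittered_cube_def restrict_in_anchored_box_iff PiE_iff space_PiM
            Int_iff mem_Collect_eq space_lborel space_borel UNIV_I)
  qed
  have "emeasure lborel (?A j) \<noteq> \<infinity>" for j
  proof -
    have "emeasure lborel (?A j) \<le> emeasure lborel (?c j)" by (intro emeasure_mono) auto
    also have "\<dots> < \<infinity>" using fin_c by (simp add: less_top)
    finally show ?thesis by simp
  qed
  hence "measure (leb ?D) (jittered_cube d m i \<inter> ?B) = (\<Prod>j\<in>?D. measure lborel (?A j))"
    unfolding cap by (intro measure_leb_PiE(2)) simp_all
  also have "\<dots> = (\<Prod>j\<in>?D. (if j \<in> s then cell_cdf m (i j) (x j) else 1) * (1 / real m))"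
  proof (rule prod.cong[OF refl])
    fix j assume j: "j \<in> ?D"
    show "measure lborel (?A j) = (if j \<in> s then cell_cdf m (i j) (x j) else 1) * (1 / real m)"
      using measure_cell_Int_initial_interval[OF i[OF j] assms(1), of "x j"] m vol[of j]
      by (auto simp: field_simps)
  qed
  also have "\<dots> = (\<Prod>j\<in>?D. if j \<in> s then cell_cdf m (i j) (x j) else 1) * (1 / real m) ^ d"
    by (simp only: prod.distrib prod_constant) simp
  also have "(\<Prod>j\<in>?D. if j \<in> s then cell_cdf m (i j) (x j) else 1) = (\<Prod>j\<in>s. cell_cdf m (i j) (x j))"
    using assms(3) by (subst prod.inter_restrict[symmetric]) (auto simp: Int_absorb1)
  finally have "measure (leb ?D) (jittered_cube d m i \<inter> ?B) = (\<Prod>j\<in>s. cell_cdf m (i j) (x j)) * (1 / real m) ^ d" .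
  thus ?thesis
    using m em me sets Bs by (subst measure_uniform_measure) auto
qed

lemma L2_discrepancy_square:
  assumes "finite s"
  shows "(L2_discrepancy s K p)\<^sup>2 = (\<integral>x. indicat_real (unit_cube s) x *
     (real (card {k \<in> K. restrict (p k) s \<in> anchored_box s x}) / real (card K) - (\<Prod>j\<in>s. x j))\<^sup>2 \<partial>leb s)"
proof -
  let ?I = "LINT x:unit_cube s|leb s.
       \<bar>real (card {k \<in> K. restrict (p k) s \<in> anchored_box s x}) / real (card K)
        - measure (leb s) (anchored_box s x)\<bar>\<^sup>2"
  have "?I \<ge> 0" unfolding set_lebesgue_integral_def by (intro integral_nonneg_AE) auto
  hence "(L2_discrepancy s K p)\<^sup>2 = ?I" by (simp add: L2_discrepancy_def)
  also have "\<dots> = (\<integral>x. indicat_real (unit_cube s) x *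
     (real (card {k \<in> K. restrict (p k) s \<in> anchored_box s x}) / real (card K) - (\<Prod>j\<in>s. x j))\<^sup>2 \<partial>leb s)"
    unfolding set_lebesgue_integral_def
    by (intro Bochner_Integration.integral_cong) (use assms in \<open>auto simp: indicator_def measure_anchored_box\<close>)
  finally show ?thesis .
qed

text \<open>
  The integrability condition of Fubini's theorem for the exchange of expectation and
  integral over the unit cube.
\<close>

lemma integrable_pair_local_discrepancy:
  assumes "prob_space M" "finite K" "finite s" "s \<subseteq> D"
    and X: "\<And>k. k \<in> K \<Longrightarrow> X k \<in> measurable M (leb D)"
  shows "integrable (M \<Otimes>\<^sub>M leb s) (\<lambda>(\<omega>, x). indicat_real (unit_cube s) x *
     (real (card {k \<in> K. restrict (X k \<omega>) s \<in> anchored_box s x}) / real (card K) - (\<Prod>j\<in>s. x j))\<^sup>2)"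
    (is "integrable ?P ?f")
proof -
  interpret prob_space M by fact
  interpret S: finite_product_sigma_finite "\<lambda>_::nat. lborel :: real measure" s by standard fact
  have Xm [measurable]: "(\<lambda>\<omega>. X k \<omega> j) \<in> borel_measurable M" if "k \<in> K" "j \<in> s" for k j
  proof -
    have "(\<lambda>y. y j) \<in> measurable (leb D) lborel"
      using that assms(4) by (intro measurable_component_singleton) auto
    from measurable_compose[OF X[OF that(1)] this] show ?thesis by simp
  qed
  have cube: "unit_cube s \<in> sets (leb s)"
    unfolding unit_cube_def by (intro sets_PiM_I_finite assms) auto
  \<comment> \<open>Written as a polynomial in indicators, the count is visibly jointly measurable.\<close>
  have cnt: "real (card {k \<in> K. restrict (X k \<omega>) s \<in> anchored_box s x})
       = (\<Sum>k\<in>K. \<Prod>j\<in>s. if 0 \<le> X k \<omega> j \<and> X k \<omega> j < x j then 1 else 0)" for \<omega> x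
  proof -
    have "(\<Prod>j\<in>s. if 0 \<le> X k \<omega> j \<and> X k \<omega> j < x j then 1 else 0)
        = (if restrict (X k \<omega>) s \<in> anchored_box s x then 1 else 0::real)" for k
      using assms(3) by (auto simp: restrict_in_anchored_box_iff prod_zero_iff)
    thus ?thesis using assms(2) by (simp add: sum.If_cases Int_def)
  qed
  have fm: "?f \<in> borel_measurable ?P"
    unfolding cnt using cube by measurable
  have le: "\<bar>?f (\<omega>, x)\<bar> \<le> 1" if "x \<in> unit_cube s" for \<omega> x
  proof -
    let ?a = "real (card {k \<in> K. restrict (X k \<omega>) s \<in> anchored_box s x}) / real (card K)"
    have "card {k \<in> K. restrict (X k \<omega>) s \<in> anchored_box s x} \<le> card K"
      using assms(2) by (intro card_mono) auto
    hence "0 \<le> ?a" "?a \<le> 1" by (auto simp: divide_le_eq_1)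
    moreover have "0 \<le> (\<Prod>j\<in>s. x j)" "(\<Prod>j\<in>s. x j) \<le> 1"
      using that by (auto simp: unit_cube_def PiE_iff intro!: prod_nonneg prod_le_1)
    ultimately have "\<bar>?a - (\<Prod>j\<in>s. x j)\<bar> \<le> 1" by linarith
    thus ?thesis using that by (simp add: abs_square_le_1)
  qed
  have "emeasure ?P (space M \<times> unit_cube s) = emeasure (leb s) (unit_cube s)"
    using cube by (simp add: S.emeasure_pair_measure_Times emeasure_space_1)
  also have "\<dots> < \<infinity>"
    unfolding unit_cube_def by (subst measure_leb_PiE(1)) (use assms in auto)
  finally have fin: "emeasure ?P (space M \<times> unit_cube s) < \<infinity>" .
  show ?thesis
  proof (rule integrableI_bounded_set[OF _ fm fin, where B = 1])
    show "space M \<times> unit_cube s \<in> sets ?P" using cube by auto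
    show "AE z in ?P. z \<in> space M \<times> unit_cube s \<longrightarrow> norm (?f z) \<le> 1"
      using le by (intro AE_I2) auto
    show "AE z in ?P. z \<notin> space M \<times> unit_cube s \<longrightarrow> ?f z = 0"
      by (intro AE_I2) (auto simp: space_pair_measure indicator_def)
  qed
qed

text \<open>
  Since the count is unbiased, this mean square is a variance.  The first product is
  \<open>m\<close> to the power \<open>card s\<close> times the volume of the box, but keeping both products in the
  same shape lets one argument integrate them.
\<close>

lemma expectation_local_discrepancy:
  assumes "m \<ge> 1" "jittered_point_set d m M X" "s \<subseteq> {1..d}" "x \<in> unit_cube s"
  shows "(\<integral>\<omega>. (real (card {k \<in> multi_indices d m. restrict (X k \<omega>) s \<in> anchored_box s x})
             / real (card (multi_indices d m)) - (\<Prod>j\<in>s. x j))\<^sup>2 \<partial>M)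
       = 1 / real m ^ (d + card s) *
         ((\<Prod>j\<in>s. \<Sum>a=1..m. cell_cdf m a (x j)) - (\<Prod>j\<in>s. \<Sum>a=1..m. (cell_cdf m a (x j))\<^sup>2))"
proof -
  interpret prob_space M using assms(2) by (simp add: jittered_point_set_def)
  let ?K = "multi_indices d m" and ?B = "{y \<in> space (leb {1..d}). restrict y s \<in> anchored_box s x}"
  define p where "p k = prob (X k -` ?B \<inter> space M)" for k
  have fin: "finite s" using assms(3) finite_subset by blast
  have m: "real m > 0" using assms(1) by simp
  have cs: "card s \<le> d" using card_mono[OF _ assms(3)] by simp
  have ind: "indep_vars (\<lambda>_. leb {1..d}) X ?K"
    and dist: "\<And>k. k \<in> ?K \<Longrightarrow> distr M (leb {1..d}) (X k) = uniform_measure (leb {1..d}) (jittered_cube d m k)"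
    using assms(2) by (auto simp: jittered_point_set_def)
  have X: "X k \<in> measurable M (leb {1..d})" if "k \<in> ?K" for k
    using ind that unfolding indep_vars_def2 by auto
  have B: "?B \<in> sets (leb {1..d})"
    by (rule sets_projection_in_anchored_box[OF _ assms(3)]) simp
  have p: "p k = (\<Prod>j\<in>s. cell_cdf m (k j) (x j))" if "k \<in> ?K" for k
  proof -
    have "p k = measure (distr M (leb {1..d}) (X k)) ?B"
      unfolding p_def using measure_distr[OF X[OF that] B] by simp
    also have "\<dots> = (\<Prod>j\<in>s. cell_cdf m (k j) (x j))"
      using dist[OF that] uniform_jittered_cube_anchored_box[OF assms(1) that assms(3)] by simp
    finally show ?thesis .
  qed
  have pow: "real m ^ (d - card s) * real m ^ card s = real m ^ d"
    using cs by (simp flip: power_add)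
  have sp: "(\<Sum>k\<in>?K. p k) = real m ^ (d - card s) * (\<Prod>j\<in>s. \<Sum>a=1..m. cell_cdf m a (x j))"
    using sum_multi_indices_prod[OF assms(3), of "\<lambda>a j. cell_cdf m a (x j)" m] p by simp
  have sp2: "(\<Sum>k\<in>?K. (p k)\<^sup>2) = real m ^ (d - card s) * (\<Prod>j\<in>s. \<Sum>a=1..m. (cell_cdf m a (x j))\<^sup>2)"
    using sum_multi_indices_prod[OF assms(3), of "\<lambda>a j. (cell_cdf m a (x j))\<^sup>2" m] p
    by (simp add: prod_power_distrib)
  have "(\<Prod>j\<in>s. \<Sum>a=1..m. cell_cdf m a (x j)) = (\<Prod>j\<in>s. real m * x j)"
    using assms(4) by (intro prod.cong) (auto simp: unit_cube_def PiE_iff sum_cell_cdf simp del: One_nat_def)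
  hence mean: "(\<Sum>k\<in>?K. p k) = real m ^ d * (\<Prod>j\<in>s. x j)"
    unfolding sp by (simp add: prod.distrib pow[symmetric])
  have "(\<integral>\<omega>. (real (card {k \<in> ?K. restrict (X k \<omega>) s \<in> anchored_box s x}) / real (card ?K) - (\<Prod>j\<in>s. x j))\<^sup>2 \<partial>M)
      = (\<integral>\<omega>. (real (card {k \<in> ?K. X k \<omega> \<in> ?B}) - (\<Sum>k\<in>?K. p k))\<^sup>2 / (real m ^ d)\<^sup>2 \<partial>M)"
  proof (rule Bochner_Integration.integral_cong[OF refl])
    fix \<omega> assume "\<omega> \<in> space M"
    hence "{k \<in> ?K. restrict (X k \<omega>) s \<in> anchored_box s x} = {k \<in> ?K. X k \<omega> \<in> ?B}"
      using X by (auto dest: measurable_space)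
    hence "real (card {k \<in> ?K. restrict (X k \<omega>) s \<in> anchored_box s x}) / real (card ?K) - (\<Prod>j\<in>s. x j)
        = (real (card {k \<in> ?K. X k \<omega> \<in> ?B}) - (\<Sum>k\<in>?K. p k)) / real m ^ d"
      unfolding mean using m by (simp add: card_multi_indices diff_divide_distrib)
    thus "(real (card {k \<in> ?K. restrict (X k \<omega>) s \<in> anchored_box s x}) / real (card ?K) - (\<Prod>j\<in>s. x j))\<^sup>2
        = (real (card {k \<in> ?K. X k \<omega> \<in> ?B}) - (\<Sum>k\<in>?K. p k))\<^sup>2 / (real m ^ d)\<^sup>2"
      by (simp only: power_divide)
  qed
  also have "\<dots> = (\<Sum>k\<in>?K. p k * (1 - p k)) / (real m ^ d)\<^sup>2"
    using count_indep_variance[OF _ ind, of "\<lambda>_. ?B"] B by (simp only: integral_divide_zero p_def) simp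
  also have "(\<Sum>k\<in>?K. p k * (1 - p k)) = (\<Sum>k\<in>?K. p k) - (\<Sum>k\<in>?K. (p k)\<^sup>2)"
    by (simp add: algebra_simps power2_eq_square sum_subtractf)
  also have "\<dots> = real m ^ (d - card s) *
     ((\<Prod>j\<in>s. \<Sum>a=1..m. cell_cdf m a (x j)) - (\<Prod>j\<in>s. \<Sum>a=1..m. (cell_cdf m a (x j))\<^sup>2))"
    unfolding sp sp2 by (simp add: right_diff_distrib)
  also have "real m ^ (d - card s) * Y / (real m ^ d)\<^sup>2 = 1 / real m ^ (d + card s) * Y" for Y
    using m by (simp add: power2_eq_square power_add pow[symmetric])
  finally show ?thesis .
qed

lemma expectation_L2_discrepancy:
  assumes "m \<ge> 1" "jittered_point_set d m M X" "s \<subseteq> {1..d}"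
  shows "integrable M (\<lambda>\<omega>. (L2_discrepancy s (multi_indices d m) (\<lambda>i. X i \<omega>))\<^sup>2)"
    and "(\<integral>\<omega>. (L2_discrepancy s (multi_indices d m) (\<lambda>i. X i \<omega>))\<^sup>2 \<partial>M)
       = 1 / real m ^ (d + card s) *
         (((real m - 1) / 2 + 1 / 2) ^ card s - ((real m - 1) / 2 + 1 / 3) ^ card s)"
proof -
  interpret prob_space M using assms(2) by (simp add: jittered_point_set_def)
  have fin: "finite s" using assms(3) finite_subset by blast
  interpret S: finite_product_sigma_finite "\<lambda>_::nat. lborel :: real measure" s by standard fact
  interpret PS: pair_sigma_finite M "leb s" ..
  let ?K = "multi_indices d m"
  let ?f = "\<lambda>\<omega> x. indicat_real (unit_cube s) x *
     (real (card {k \<in> ?K. restrict (X k \<omega>) s \<in> anchored_box s x}) / real (card ?K) - (\<Prod>j\<in>s. x j))\<^sup>2"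
  let ?g = "\<lambda>t. \<Sum>a=1..m. cell_cdf m a t" and ?h = "\<lambda>t. \<Sum>a=1..m. (cell_cdf m a t)\<^sup>2"
  have X: "X k \<in> measurable M (leb {1..d})" if "k \<in> ?K" for k
    using assms(2) that unfolding jittered_point_set_def indep_vars_def2 by auto
  have int: "integrable (M \<Otimes>\<^sub>M leb s) (\<lambda>(\<omega>, x). ?f \<omega> x)"
    by (rule integrable_pair_local_discrepancy[OF prob_space_axioms _ fin assms(3) X]) simp
  show "integrable M (\<lambda>\<omega>. (L2_discrepancy s ?K (\<lambda>i. X i \<omega>))\<^sup>2)"
    using PS.integrable_fst'[OF int] by (simp add: L2_discrepancy_square[OF fin])
  have ig: "integrable lborel (\<lambda>t. indicat_real {0..1} t * ?g t)"
    unfolding sum_distrib_left using integrable_indicator_cell_cdf_power[of m _ 1]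
    by (intro Bochner_Integration.integrable_sum) simp
  have ih: "integrable lborel (\<lambda>t. indicat_real {0..1} t * ?h t)"
    unfolding sum_distrib_left using integrable_indicator_cell_cdf_power[of m _ 2]
    by (intro Bochner_Integration.integrable_sum) simp
  have "(\<integral>\<omega>. (L2_discrepancy s ?K (\<lambda>i. X i \<omega>))\<^sup>2 \<partial>M) = (\<integral>\<omega>. (\<integral>x. ?f \<omega> x \<partial>leb s) \<partial>M)"
    by (simp add: L2_discrepancy_square[OF fin])
  also have "\<dots> = (\<integral>x. (\<integral>\<omega>. ?f \<omega> x \<partial>M) \<partial>leb s)"
    by (rule PS.Fubini_integral[OF int, symmetric])
  also have "\<dots> = (\<integral>x. 1 / real m ^ (d + card s) *
       (indicat_real (unit_cube s) x * (\<Prod>j\<in>s. ?g (x j)) - indicat_real (unit_cube s) x * (\<Prod>j\<in>s. ?h (x j))) \<partial>leb s)"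
  proof (rule Bochner_Integration.integral_cong[OF refl])
    fix x
    show "(\<integral>\<omega>. ?f \<omega> x \<partial>M) = 1 / real m ^ (d + card s) *
       (indicat_real (unit_cube s) x * (\<Prod>j\<in>s. ?g (x j)) - indicat_real (unit_cube s) x * (\<Prod>j\<in>s. ?h (x j)))"
      using expectation_local_discrepancy[OF assms, of x] by (cases "x \<in> unit_cube s") auto
  qed
  also have "\<dots> = 1 / real m ^ (d + card s) *
       ((real m / 2) ^ card s - ((real m - 1) / 2 + 1 / 3) ^ card s)"
    by (simp only: integral_mult_right_zero
          Bochner_Integration.integral_diff[OF integral_unit_cube_prod(2)[OF fin ig] integral_unit_cube_prod(2)[OF fin ih]]
          integral_unit_cube_prod(1)[OF fin ig] integral_unit_cube_prod(1)[OF fin ih]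
          integral_sum_cell_cdf integral_sum_cell_cdf_square[OF assms(1)])
  also have "real m / 2 = (real m - 1) / 2 + 1 / 2" by (simp add: field_simps)
  finally show "(\<integral>\<omega>. (L2_discrepancy s ?K (\<lambda>i. X i \<omega>))\<^sup>2 \<partial>M)
       = 1 / real m ^ (d + card s) *
         (((real m - 1) / 2 + 1 / 2) ^ card s - ((real m - 1) / 2 + 1 / 3) ^ card s)" .
qed

section \<open>The Hickernell discrepancy\<close>

lemma sum_nonempty_subsets_by_card:
  fixes f :: "nat \<Rightarrow> real"
  shows "(\<Sum>s\<in>Pow {1..d} - {{}}. f (card s)) = (\<Sum>j=1..d. real (d choose j) * f j)"
proof -
  have "(\<Sum>s\<in>Pow {1..d} - {{}}. f (card s))
      = (\<Sum>j=1..d. \<Sum>s\<in>{s \<in> Pow {1..d} - {{}}. card s = j}. f (card s))"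
  proof (rule sum.group[symmetric])
    show "card ` (Pow {1..d} - {{}}) \<subseteq> {1..d}"
    proof
      fix n assume "n \<in> card ` (Pow {1..d} - {{}})"
      then obtain s where "n = card s" "s \<noteq> {}" "s \<subseteq> {1..d}" by auto
      thus "n \<in> {1..d}"
        using card_mono[of "{1..d}" s] finite_subset[of s "{1..d}"] by (auto simp: Suc_le_eq card_gt_0_iff)
    qed
  qed auto
  also have "\<dots> = (\<Sum>j=1..d. real (d choose j) * f j)"
  proof (rule sum.cong[OF refl])
    fix j assume "j \<in> {1..d}"
    hence "{s \<in> Pow {1..d} - {{}}. card s = j} = {s. s \<subseteq> {1..d} \<and> card s = j}" by auto
    thus "(\<Sum>s\<in>{s \<in> Pow {1..d} - {{}}. card s = j}. f (card s)) = real (d choose j) * f j"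
      using n_subsets[of "{1..d}" j] by simp
  qed
  finally show ?thesis .
qed

theorem theorem3:
  fixes d m :: nat
    and M :: "'a measure"
    and X :: "(nat \<Rightarrow> nat) \<Rightarrow> 'a \<Rightarrow> nat \<Rightarrow> real"
  assumes "d \<ge> 1" and "m \<ge> 2"
    and "jittered_point_set d m M X"
  shows "prob_space.expectation M
           (\<lambda>\<omega>. (hickernell_discrepancy d (multi_indices d m) (\<lambda>i. X i \<omega>))\<^sup>2) =
         (\<Sum>j=1..d. 1 / real m ^ (d + j) * real (d choose j) *
            (((real m - 1) / 2 + 1 / 2) ^ j - ((real m - 1) / 2 + 1 / 3) ^ j))"
proof -
  have m: "m \<ge> 1" using assms(2) by simp
  let ?c = "\<lambda>j. 1 / real m ^ (d + j) * (((real m - 1) / 2 + 1 / 2) ^ j - ((real m - 1) / 2 + 1 / 3) ^ j)"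
  have "(\<integral>\<omega>. (hickernell_discrepancy d (multi_indices d m) (\<lambda>i. X i \<omega>))\<^sup>2 \<partial>M)
      = (\<integral>\<omega>. (\<Sum>s\<in>Pow {1..d} - {{}}. (L2_discrepancy s (multi_indices d m) (\<lambda>i. X i \<omega>))\<^sup>2) \<partial>M)"
    by (simp add: hickernell_discrepancy_def sum_nonneg)
  also have "\<dots> = (\<Sum>s\<in>Pow {1..d} - {{}}. \<integral>\<omega>. (L2_discrepancy s (multi_indices d m) (\<lambda>i. X i \<omega>))\<^sup>2 \<partial>M)"
    using expectation_L2_discrepancy(1)[OF m assms(3)] by (intro Bochner_Integration.integral_sum) auto
  also have "\<dots> = (\<Sum>s\<in>Pow {1..d} - {{}}. ?c (card s))"
    using expectation_L2_discrepancy(2)[OF m assms(3)] by (intro sum.cong) auto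
  also have "\<dots> = (\<Sum>j=1..d. real (d choose j) * ?c j)"
    by (rule sum_nonempty_subsets_by_card)
  finally show ?thesis by (simp only: mult_ac)
qed

end
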